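(* Let $\mathcal Z$ be a commutative associative unital $\mathbb Q$-algebra, $N\in\mathbb N$, $n\in[N]$, $Z=(z_{j,r})\in\mathcal Z^{N\times n}$. Let $r\in[n]^n_{\neq}$ (a permutation $(r_1,\dots,r_n)$ of $[n]$) and $R_k=\{r_\ell:\ell\in[k]\}$ for $k\in\{0,\dots,n\}$. Then $\emptyset=R_0\subsetneq R_1\subsetneq\dots\subsetneq R_n=[n]$ is a maximal chain of subsets of $[n]$, and $$\overline p_{[n]}-\frac{N!\,\widetilde p_{[n]}}{(N-n)!}=-\frac1{2N}\sum_{k=2}^n\sum_{s\in R_{k-1}}\sum_{j\in[N]^n_{\neq}}y_{j_{r_k},j_s,r_k}\,y_{j_{r_k},j_s,s}\,p_{j,R_{k-1}\setminus\{s\}}\,\widetilde p_{[n]\setminus R_k}.$$ Moreover, $$\overline p_{[n]}-\frac{N!\,\widetilde p_{[n]}}{(N-n)!}=-\sum_{k=2}^n\frac{1}{2Nk\binom nk}\sum_{\substack{R\subseteq[n]\\|R|=k}}\ \sum_{(r,s)\in R^2_{\neq}}\ \sum_{j\in[N]^n_{\neq}}y_{j_r,j_s,r}\,y_{j_r,j_s,s}\,p_{j,R\setminus\{r,s\}}\,\widetilde p_{[n]\setminus R}$$ $$=-\sum_{(u,v)\in[N]^2_{\neq}}\ \sum_{(r,s)\in[n]^2_{\neq}}y_{u,v,r}\,y_{u,v,s}\sum_{k=2}^n\frac{1}{2Nk\binom nk}\sum_{\substack{R\subseteq[n]\setminus\{r,s\}\\|R|=k-2}}\widetilde p_{[n]\setminus(R\cup\{r,s\})}\sum_{j\in([N]\setminus\{u,v\})^{[n]\setminus\{r,s\}}_{\neq}}p_{j,R}.$$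 If $n=1$, all these right-hand sides are defined to be zero.
   Context: $[m]=\{1,\dots,m\}$. For sets $A,B$, $A^B_{\neq}$ is the set of injective maps $B\to A$, with $j(b)$ written $j_b$; $[N]^n_{\neq}=[N]^{[n]}_{\neq}$, and for a set $R$, $R^2_{\neq}=\{(r,s)\in R^2:r\ne s\}$. $\widetilde z_r=\frac1N\sum_{j=1}^Nz_{j,r}$, $y_{j,k,r}=z_{j,r}-z_{k,r}$. For $R\subseteq[n]$ and an injective map $j$ from a set containing $R$ into $[N]$, $p_{j,R}=\prod_{\ell\in R}z_{j_\ell,\ell}$. $\overline p_R=\sum_{j\in[N]^n_{\neq}}p_{j,R}$ (so $\overline p_{[n]}$ is the permanent of $Z$) and $\widetilde p_R=\prod_{\ell\in R}\widetilde z_\ell$. Empty sums are $0$, empty products are $1$. *)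

theory Defs
  imports Complex_Main "HOL-Library.FuncSet"
begin

(* Commutative associative unital Q-algebras. The sort {comm_ring, comm_monoid_mult} is that of
   commutative rings with one in which 0 = 1 is permitted, so that, unlike for comm_ring_1, the zero
   algebra is included. By commutativity, compatibility of the scalars with the left factor of a
   product is enough. *)
locale rat_algebra = vector_space scale
  for scale :: "rat \<Rightarrow> 'a::{comm_ring, comm_monoid_mult} \<Rightarrow> 'a" +
  assumes scale_mult: "scale q (x * y) = scale q x * y"

(* inj_maps B A is the set of injective maps from B to A; PiE makes the maps take the value undefined
   outside of B, so that each map on B is counted exactly once. *)
definition inj_maps :: "'b set \<Rightarrow> 'c set \<Rightarrow> ('b \<Rightarrow> 'c) set" where
  "inj_maps B A = {j \<in> B \<rightarrow>\<^sub>E A. inj_on j B}"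

definition distinct_pairs :: "'b set \<Rightarrow> ('b \<times> 'b) set" where
  "distinct_pairs R = {(r, s) \<in> R \<times> R. r \<noteq> s}"

(* An N x n matrix is a function z on indices; only the entries z j r with j in {1..N} and r in {1..n}
   are relevant. *)

definition col_mean :: "(rat \<Rightarrow> 'a \<Rightarrow> 'a) \<Rightarrow> (nat \<Rightarrow> nat \<Rightarrow> 'a::comm_ring) \<Rightarrow> nat \<Rightarrow> nat \<Rightarrow> 'a" where
  "col_mean scale z N r = scale (1 / of_nat N) (\<Sum>j\<in>{1..N}. z j r)"

definition col_diff :: "(nat \<Rightarrow> nat \<Rightarrow> 'a::comm_ring) \<Rightarrow> nat \<Rightarrow> nat \<Rightarrow> nat \<Rightarrow> 'a" where
  "col_diff z j k r = z j r - z k r"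

definition prod_along ::
    "(nat \<Rightarrow> nat \<Rightarrow> 'a::{comm_ring, comm_monoid_mult}) \<Rightarrow> (nat \<Rightarrow> nat) \<Rightarrow> nat set \<Rightarrow> 'a" where
  "prod_along z j R = (\<Prod>l\<in>R. z (j l) l)"

(* For R = {1..n} this is the permanent of the N x n matrix z. *)
definition prod_bar ::
    "(nat \<Rightarrow> nat \<Rightarrow> 'a::{comm_ring, comm_monoid_mult}) \<Rightarrow> nat \<Rightarrow> nat \<Rightarrow> nat set \<Rightarrow> 'a" where
  "prod_bar z N n R = (\<Sum>j\<in>inj_maps {1..n} {1..N}. prod_along z j R)"

definition prod_mean ::
    "(rat \<Rightarrow> 'a \<Rightarrow> 'a) \<Rightarrow> (nat \<Rightarrow> nat \<Rightarrow> 'a::{comm_ring, comm_monoid_mult}) \<Rightarrow> nat \<Rightarrow> nat set \<Rightarrow> 'a" where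
  "prod_mean scale z N R = (\<Prod>l\<in>R. col_mean scale z N l)"

definition prefix_set :: "(nat \<Rightarrow> nat) \<Rightarrow> nat \<Rightarrow> nat set" where
  "prefix_set \<rho> k = \<rho> ` {1..k}"

end

theory Submission
  imports Defs "HOL-Combinatorics.Transposition"
begin

text \<open>
  The hybrid \<open>A\<^sub>R\<close>, the product of the permanent sum over the columns in \<open>R\<close> and of the column means outside \<open>R\<close>,
  interpolates between the product of the means (\<open>R = {}\<close>) and the permanent (\<open>R = {1..n}\<close>). Adding a
  column \<open>r\<close> to \<open>R\<close> replaces the mean of column \<open>r\<close> by its entry at \<open>j r\<close>. By symmetry, averaging column \<open>r\<close>
  over the values outside \<open>j ` R\<close> changes nothing, so that only the differences between the rows \<open>j r\<close> and
  \<open>j s\<close> with \<open>s \<in> R\<close> survive; exchanging \<open>j r\<close> and \<open>j s\<close> symmetrises them into products of two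
  differences. Telescoping along a chain gives the first formula, and telescoping the mean of \<open>A\<^sub>R\<close> over
  all \<open>R\<close> with \<open>card R = k\<close> gives the second one.
\<close>

section \<open>Injective maps: their number and their composition with transpositions\<close>

lemma finite_inj_maps: "finite B \<Longrightarrow> finite A \<Longrightarrow> finite (inj_maps B A)"
  unfolding inj_maps_def by (rule finite_subset[OF _ finite_PiE[of B "\<lambda>_. A"]]) auto

lemma inj_mapsD:
  assumes "j \<in> inj_maps B A"
  shows "inj_on j B" and "x \<in> B \<Longrightarrow> j x \<in> A" and "x \<notin> B \<Longrightarrow> j x = undefined"
  using assms by (auto simp: inj_maps_def dest: PiE_mem PiE_arb)

lemma card_inj_maps:
  assumes "finite B" "finite A" "card B \<le> card A"
  shows "(of_nat (card (inj_maps B A)) :: rat) = fact (card A) / fact (card A - card B)"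
proof -
  have "card (inj_maps B A) = prod ((-) (card A)) {0..<card B}"
    using card_inj_on_subset_funcset[of B A B] assms by (simp add: inj_maps_def)
  \<comment> \<open>Multiplying the falling factorial by \<open>fact (a - b)\<close> keeps the
    induction inside the natural numbers; the division takes place only in
    \<open>rat\<close>.\<close>
  moreover have "b \<le> a \<Longrightarrow> prod ((-) a) {0..<b} * fact (a - b) = (fact a :: nat)" for a b
  proof (induction b)
    case (Suc b)
    then have "fact (a - b) = (a - b) * (fact (a - Suc b) :: nat)"
      by (metis Suc_diff_Suc Suc_le_lessD fact_Suc of_nat_id)
    then show ?case
      using Suc by simp
  qed simp
  ultimately have "card (inj_maps B A) * fact (card A - card B) = (fact (card A) :: nat)"
    using assms by simp
  then have "(of_nat (card (inj_maps B A)) :: rat) * fact (card A - card B) = fact (card A)"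
    by (metis of_nat_fact of_nat_mult)
  then show ?thesis
    by (simp add: field_simps)
qed

text \<open>Exchanging the arguments \<open>r\<close> and \<open>s\<close> fixes every point outside
  \<open>B\<close>, so the value \<open>undefined\<close> there survives without
  \<open>restrict\<close>.\<close>

lemma comp_transpose_inj_maps:
  assumes "j \<in> inj_maps B A" "r \<in> B" "s \<in> B"
  shows "j \<circ> transpose r s \<in> inj_maps B A"
proof -
  have tr: "transpose r s x \<in> B \<longleftrightarrow> x \<in> B" for x
    using assms by (simp add: transpose_def)
  have "inj_on (j \<circ> transpose r s) B"
    by (rule comp_inj_on) (use inj_mapsD(1)[OF assms(1)] assms in \<open>simp_all add: transpose_image_eq\<close>)
  moreover have "(j \<circ> transpose r s) x \<in> A" if "x \<in> B" for x
    using inj_mapsD(2)[OF assms(1)] that by (simp add: tr)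
  moreover have "(j \<circ> transpose r s) x = undefined" if "x \<notin> B" for x
    using inj_mapsD(3)[OF assms(1)] that by (simp add: tr)
  ultimately show ?thesis
    by (simp add: inj_maps_def PiE_iff extensional_def)
qed

text \<open>Here the values are exchanged, and \<open>restrict\<close> guards against
  \<open>undefined\<close> being one of the two values that the transposition moves.\<close>

lemma transpose_comp_inj_maps:
  assumes "j \<in> inj_maps B A" "u \<in> A" "v \<in> A"
  shows "restrict (transpose u v \<circ> j) B \<in> inj_maps B A"
proof -
  have "inj_on (transpose u v \<circ> j) B"
    by (rule comp_inj_on) (use inj_mapsD(1)[OF assms(1)] in simp_all)
  moreover have "transpose u v (j x) \<in> A" if "x \<in> B" for x
    using assms inj_mapsD(2)[OF assms(1) that] by (simp add: transpose_def)
  ultimately show ?thesis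
    by (simp add: inj_maps_def inj_on_restrict_eq)
qed

section \<open>Products along a map and symmetries of their sums over injective maps\<close>

lemma prod_along_cong: "(\<And>l. l \<in> R \<Longrightarrow> i l = j l) \<Longrightarrow> prod_along z i R = prod_along z j R"
  by (simp add: prod_along_def)

lemma prod_along_insert:
  "finite R \<Longrightarrow> r \<notin> R \<Longrightarrow> prod_along z j (insert r R) = z (j r) r * prod_along z j R"
  by (simp add: prod_along_def)

lemma prod_along_remove:
  "finite R \<Longrightarrow> r \<in> R \<Longrightarrow> prod_along z j R = z (j r) r * prod_along z j (R - {r})"
  unfolding prod_along_def by (rule prod.remove)

text \<open>Exchanging the values of \<open>j\<close> at \<open>r\<close> and \<open>s\<close> changes the sign of \<open>col_diff z (j r) (j s) r\<close>.\<close>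

lemma sum_inj_maps_exchange:
  fixes z :: "nat \<Rightarrow> nat \<Rightarrow> 'a::{comm_ring, comm_monoid_mult}"
  assumes "r \<in> B" "s \<in> B" "r \<notin> R" "s \<notin> R"
  shows "(\<Sum>j\<in>inj_maps B A. col_diff z (j r) (j s) r * z (j r) s * prod_along z j R) =
    - (\<Sum>j\<in>inj_maps B A. col_diff z (j r) (j s) r * z (j s) s * prod_along z j R)"
proof -
  have along: "prod_along z (j \<circ> transpose r s) R = prod_along z j R" for j
    using assms by (intro prod_along_cong) (metis comp_apply transpose_apply_other)
  show ?thesis
    unfolding sum_negf[symmetric]
    by (rule sum.reindex_bij_witness[where i = "\<lambda>j. j \<circ> transpose r s" and j = "\<lambda>j. j \<circ> transpose r s"])
      (use assms in \<open>auto simp: comp_assoc along comp_transpose_inj_maps col_diff_def algebra_simps\<close>)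
qed

text \<open>For \<open>i \<notin> j ` R\<close>, composing \<open>j\<close> with the transposition of \<open>i\<close> and \<open>j r\<close> interchanges
  \<open>i\<close> and \<open>j r\<close> without affecting \<open>j\<close> on \<open>R\<close>.\<close>

lemma sum_inj_maps_complement:
  fixes z :: "nat \<Rightarrow> nat \<Rightarrow> 'a::{comm_ring, comm_monoid_mult}"
  assumes "finite B" "finite A" "R \<subseteq> B" "r \<in> B" "r \<notin> R"
  shows "(\<Sum>j\<in>inj_maps B A. \<Sum>i\<in>A - j ` R. prod_along z j R * z i r) =
    (\<Sum>j\<in>inj_maps B A. \<Sum>i\<in>A - j ` R. prod_along z j R * z (j r) r)"
proof -
  define P where "P = (SIGMA j:inj_maps B A. A - j ` R)"
  \<comment> \<open>\<open>\<phi>\<close> moves \<open>i\<close> to column \<open>r\<close> and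
    stores the old value \<open>j r\<close> in the second component. If another column, necessarily
    outside \<open>R\<close>, had the value \<open>i\<close>, it receives \<open>j r\<close>; so
    injectivity is kept and \<open>\<phi>\<close> is an involution on \<open>P\<close>.\<close>
  define \<phi> :: "(nat \<Rightarrow> nat) \<times> nat \<Rightarrow> (nat \<Rightarrow> nat) \<times> nat"
    where "\<phi> = (\<lambda>(j, i). (restrict (transpose i (j r) \<circ> j) B, j r))"
  have on_R: "(transpose i (j r) \<circ> j) x = j x" if "(j, i) \<in> P" "x \<in> R" for j i x
  proof -
    have "j x \<noteq> j r"
      using that assms by (auto simp: P_def dest!: inj_mapsD(1) inj_onD)
    then show ?thesis
      using that by (auto simp: P_def transpose_def)
  qed
  have img: "restrict (transpose i (j r) \<circ> j) B ` R = j ` R" if "(j, i) \<in> P" for j i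
    using on_R[OF that] assms by (intro image_cong) auto
  have mem: "\<phi> x \<in> P" if "x \<in> P" for x
  proof -
    obtain j i where x: "x = (j, i)"
      by force
    have "j r \<notin> j ` R"
      using that assms by (auto simp: x P_def dest!: inj_mapsD(1) inj_onD)
    then show ?thesis
      using that assms img[of j i] transpose_comp_inj_maps[of j B A i "j r"] inj_mapsD(2)[of j B A r]
      by (auto simp: x \<phi>_def P_def)
  qed
  have inv: "\<phi> (\<phi> x) = x" if "x \<in> P" for x
  proof -
    obtain j i where x: "x = (j, i)"
      by force
    have "transpose (j r) i (transpose i (j r) y) = y" for y
      by (metis transpose_commute transpose_involutory)
    moreover have "l \<notin> B \<Longrightarrow> j l = undefined" for l
      using that inj_mapsD(3)[of j B A l] by (simp add: x P_def)
    ultimately show ?thesis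
      using assms by (auto simp: x \<phi>_def fun_eq_iff)
  qed
  have val: "(case \<phi> x of (j, i) \<Rightarrow> prod_along z j R * z (j r) r) =
      (case x of (j, i) \<Rightarrow> prod_along z j R * z i r)" if "x \<in> P" for x
  proof -
    obtain j i where x: "x = (j, i)"
      by force
    have "prod_along z (restrict (transpose i (j r) \<circ> j) B) R = prod_along z j R"
      using on_R[of j i] that assms x by (intro prod_along_cong) auto
    then show ?thesis
      using assms by (simp add: x \<phi>_def)
  qed
  have "(\<Sum>(j, i)\<in>P. prod_along z j R * z i r) = (\<Sum>(j, i)\<in>P. prod_along z j R * z (j r) r)"
    by (rule sum.reindex_bij_witness[where i = \<phi> and j = \<phi>]) (use mem inv val in auto)
  then show ?thesis
    using assms by (simp add: P_def sum.Sigma finite_inj_maps)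
qed

section \<open>Double counting for sums over subsets and over injective maps\<close>

lemma sum_insert_subsets:
  fixes f :: "'b set \<Rightarrow> 'b \<Rightarrow> 'c::comm_monoid_add"
  assumes "finite S" "k \<ge> 1"
  shows "(\<Sum>R\<in>{R. R \<subseteq> S \<and> card R = k}. \<Sum>r\<in>R. f (R - {r}) r) =
    (\<Sum>R\<in>{R. R \<subseteq> S \<and> card R = k - 1}. \<Sum>r\<in>S - R. f R r)"
proof -
  have fin: "R \<subseteq> S \<Longrightarrow> finite R" for R
    using assms(1) by (rule rev_finite_subset)
  \<comment> \<open>Both sides run over sets with one marked element, which is either kept in the
    set or taken out. For \<open>k = 0\<close> truncated subtraction would leave the empty set on
    the right, with every element of \<open>S\<close> marked.\<close>
  have "(\<Sum>(R, r)\<in>(SIGMA R:{R. R \<subseteq> S \<and> card R = k}. R). f (R - {r}) r) =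
      (\<Sum>(R, r)\<in>(SIGMA R:{R. R \<subseteq> S \<and> card R = k - 1}. S - R). f R r)"
    by (rule sum.reindex_bij_witness[where i = "\<lambda>(R, r). (insert r R, r)" and j = "\<lambda>(R, r). (R - {r}, r)"])
      (use assms(2) in \<open>auto simp: insert_absorb card_Diff_singleton fin\<close>)
  then show ?thesis
    using assms(1) by (simp add: sum.Sigma fin)
qed

text \<open>The same double counting with an ordered pair of marked elements: choose the pair first,
  then the other \<open>k - 2\<close> elements. The bound on \<open>k\<close> keeps this subtraction
  from being truncated.\<close>

lemma sum_distinct_pairs_subsets:
  fixes f :: "'b set \<Rightarrow> 'b \<times> 'b \<Rightarrow> 'c::comm_monoid_add"
  assumes "finite S" "k \<ge> 2"
  shows "(\<Sum>R\<in>{R. R \<subseteq> S \<and> card R = k}. \<Sum>p\<in>distinct_pairs R. f R p) =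
    (\<Sum>p\<in>distinct_pairs S. \<Sum>R\<in>{R. R \<subseteq> S - {fst p, snd p} \<and> card R = k - 2}. f (R \<union> {fst p, snd p}) p)"
proof -
  have fin: "R \<subseteq> S \<Longrightarrow> finite R" for R
    using assms(1) by (rule rev_finite_subset)
  have finp: "R \<subseteq> S \<Longrightarrow> finite (distinct_pairs R)" for R
    unfolding distinct_pairs_def by (rule finite_subset[of _ "R \<times> R"]) (auto simp: fin)
  have card_minus: "card (R - {r, s}) = k - 2" if "R \<subseteq> S" "card R = k" "r \<in> R" "s \<in> R" "r \<noteq> s" for R r s
    using that by (simp add: card_Diff_subset)
  have card_plus: "card (R \<union> {r, s}) = k" if "R \<subseteq> S - {r, s}" "card R = k - 2" "r \<noteq> s" for R r s
  proof -
    have "finite R" "r \<notin> R" "s \<notin> R"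
      using that fin by auto
    then show ?thesis
      using that assms(2) by simp
  qed
  have "(\<Sum>(R, p)\<in>(SIGMA R:{R. R \<subseteq> S \<and> card R = k}. distinct_pairs R). f R p) =
      (\<Sum>(p, R)\<in>(SIGMA p:distinct_pairs S. {R. R \<subseteq> S - {fst p, snd p} \<and> card R = k - 2}).
        f (R \<union> {fst p, snd p}) p)"
    by (rule sum.reindex_bij_witness[where i = "\<lambda>(p, R). (R \<union> {fst p, snd p}, p)"
          and j = "\<lambda>(R, p). (p, R - {fst p, snd p})"])
      (use card_plus card_minus in \<open>auto simp: distinct_pairs_def insert_absorb intro!: arg_cong2[of _ _ _ _ f]\<close>)
  then show ?thesis
    using assms(1) by (simp add: sum.Sigma finp)
qed

text \<open>An injective map is determined by its values \<open>u\<close>, \<open>v\<close> at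
  \<open>r\<close>, \<open>s\<close> and its restriction to the other arguments, which is an
  arbitrary injective map avoiding \<open>u\<close> and \<open>v\<close>. This serves to pull the
  row pair out of the sum over \<open>j\<close>.\<close>

lemma sum_inj_maps_split:
  fixes f :: "('b \<Rightarrow> 'c) \<Rightarrow> 'd::comm_monoid_add"
  assumes "finite B" "finite A" "r \<in> B" "s \<in> B" "r \<noteq> s"
  shows "(\<Sum>j\<in>inj_maps B A. f j) =
    (\<Sum>p\<in>distinct_pairs A. \<Sum>j\<in>inj_maps (B - {r, s}) (A - {fst p, snd p}). f (j(r := fst p, s := snd p)))"
proof -
  have finp: "finite (distinct_pairs A)"
    unfolding distinct_pairs_def by (rule finite_subset[of _ "A \<times> A"]) (auto simp: assms)
  have i: "j(r := u, s := v) \<in> inj_maps B A"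
    if "(u, v) \<in> distinct_pairs A" "j \<in> inj_maps (B - {r, s}) (A - {u, v})" for u v j
  proof -
    have ne: "j x \<in> A" "j x \<noteq> u" "j x \<noteq> v" if "x \<in> B - {r, s}" for x
      using inj_mapsD(2)[OF \<open>j \<in> _\<close> that] by auto
    have "inj_on (j(r := u, s := v)) B"
    proof (rule inj_onI)
      fix x y assume "x \<in> B" "y \<in> B" "(j(r := u, s := v)) x = (j(r := u, s := v)) y"
      then show "x = y"
        using ne[of x] ne[of y] \<open>(u, v) \<in> _\<close> inj_onD[OF inj_mapsD(1)[OF \<open>j \<in> _\<close>], of x y]
        by (auto simp: distinct_pairs_def split: if_splits)
    qed
    then show ?thesis
      using ne \<open>(u, v) \<in> _\<close> inj_mapsD(3)[OF \<open>j \<in> _\<close>] assms(3-)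
      by (auto simp: inj_maps_def PiE_iff extensional_def distinct_pairs_def)
  qed
  have ri: "restrict (j(r := u, s := v)) (B - {r, s}) = j"
    if "j \<in> inj_maps (B - {r, s}) (A - {u, v})" for u v j
    using inj_mapsD(3)[OF that] by (auto simp: fun_eq_iff)
  have d: "(j r, j s) \<in> distinct_pairs A" if "j \<in> inj_maps B A" for j
    using inj_mapsD[OF that] assms(3-) by (auto simp: distinct_pairs_def dest: inj_onD)
  have e: "restrict j (B - {r, s}) \<in> inj_maps (B - {r, s}) (A - {j r, j s})" if "j \<in> inj_maps B A" for j
    using inj_mapsD[OF that] assms(3-) by (auto simp: inj_maps_def inj_on_def)
  have ir: "(restrict j (B - {r, s}))(r := j r, s := j s) = j" if "j \<in> inj_maps B A" for j
    using inj_mapsD(3)[OF that] by (auto simp: fun_eq_iff)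
  have "sum f (inj_maps B A) =
      (\<Sum>(p, j)\<in>(SIGMA p:distinct_pairs A. inj_maps (B - {r, s}) (A - {fst p, snd p})).
        f (j(r := fst p, s := snd p)))"
    by (rule sum.reindex_bij_witness[where i = "\<lambda>(p, j). j(r := fst p, s := snd p)"
          and j = "\<lambda>j. ((j r, j s), restrict j (B - {r, s}))"])
      (use assms i ri d e ir in auto)
  then show ?thesis
    using assms by (simp add: sum.Sigma finp finite_inj_maps)
qed

section \<open>The chain of prefix sets\<close>

lemma prefix_set_remove:
  assumes "k \<in> {1..n}" "inj_on \<rho> {1..n}"
  shows "prefix_set \<rho> (k - 1) = prefix_set \<rho> k - {\<rho> k}"
proof -
  have "{1..k} = insert k {1..k - 1}"
    using assms(1) by auto
  moreover have "\<rho> k \<notin> \<rho> ` {1..k - 1}"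
  proof
    assume "\<rho> k \<in> \<rho> ` {1..k - 1}"
    then obtain l where "l \<in> {1..k - 1}" "\<rho> k = \<rho> l"
      by auto
    then show False
      using assms(1) inj_onD[OF assms(2), of k l] by fastforce
  qed
  ultimately show ?thesis
    by (simp add: prefix_set_def)
qed

lemma prefix_set_full: "\<rho> \<in> inj_maps {1..n} {1..n} \<Longrightarrow> prefix_set \<rho> n = {1..n}"
  unfolding prefix_set_def
  by (rule endo_inj_surj) (auto dest: inj_mapsD)

lemma prefix_set_mono: "k \<le> l \<Longrightarrow> prefix_set \<rho> k \<subseteq> prefix_set \<rho> l"
  by (auto simp: prefix_set_def)

text \<open>The chain has a member of each cardinality from \<open>0\<close> to \<open>n\<close>. A
  set comparable with the member of its own cardinality equals that member, so nothing can be
  added.\<close>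

lemma maxchain_prefix_set:
  assumes "\<rho> \<in> inj_maps {1..n} {1..n}"
  shows "subset.maxchain (Pow {1..n}) (prefix_set \<rho> ` {0..n})"
proof -
  have sub: "prefix_set \<rho> k \<subseteq> {1..n}" if "k \<le> n" for k
    using prefix_set_mono[OF that, of \<rho>] prefix_set_full[OF assms] by simp
  have card: "card (prefix_set \<rho> k) = k" if "k \<le> n" for k
    using that inj_on_subset[OF inj_mapsD(1)[OF assms], of "{1..k}"]
    by (simp add: prefix_set_def card_image)
  have "prefix_set \<rho> k \<subseteq> prefix_set \<rho> l \<or> prefix_set \<rho> l \<subseteq> prefix_set \<rho> k" for k l
    using nat_le_linear[of k l] prefix_set_mono by blast
  then have chain: "subset.chain (Pow {1..n}) (prefix_set \<rho> ` {0..n})"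
    unfolding subset_chain_def using sub by (simp add: image_subset_iff)
  have "X \<in> prefix_set \<rho> ` {0..n}"
    if S: "subset.chain (Pow {1..n}) S" "prefix_set \<rho> ` {0..n} \<subseteq> S" "X \<in> S" for S X
  proof -
    have X: "X \<subseteq> {1..n}" "finite X"
      using S finite_subset[of X "{1..n}"] by (auto simp: subset.chain_def)
    then have le: "card X \<le> n"
      using card_mono[of "{1..n}" X] by simp
    then have "prefix_set \<rho> (card X) \<in> S"
      using S(2) by auto
    then have "X \<subseteq> prefix_set \<rho> (card X) \<or> prefix_set \<rho> (card X) \<subseteq> X"
      using S(1,3) subset.chain_total by fastforce
    moreover have "finite (prefix_set \<rho> (card X))"
      by (simp add: prefix_set_def)
    ultimately have "X = prefix_set \<rho> (card X)"
      using card[OF le] X(2) by (metis card_subset_eq)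
    then show ?thesis
      using le by auto
  qed
  then show ?thesis
    using chain unfolding subset.maxchain_def by blast
qed

section \<open>Change of the permanent sum and of the hybrid when a column is added\<close>

context rat_algebra
begin

lemma mult_scale_right: "x * scale q y = scale q (x * y)"
  by (metis mult.commute scale_mult)

text \<open>Write \<open>P\<close> for the sum with column \<open>r\<close> added. Splitting the
  column sum into rows inside and outside the image of \<open>R\<close> shows that \<open>N\<close>
  times the left-hand side is \<open>card R\<close> times \<open>P\<close> minus \<open>W\<close>, a
  sum over \<open>s\<close> in \<open>R\<close> of terms that the exchange of \<open>j r\<close> and
  \<open>j s\<close> symmetrises.\<close>

lemma prod_bar_insert:
  assumes "0 < N" "R \<subseteq> {1..n}" "r \<in> {1..n}" "r \<notin> R"
  shows "prod_bar z N n (insert r R) - prod_bar z N n R * col_mean scale z N r =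
    - scale (1 / (2 * of_nat N))
        (\<Sum>s\<in>R. \<Sum>j\<in>inj_maps {1..n} {1..N}.
          col_diff z (j r) (j s) r * col_diff z (j r) (j s) s * prod_along z j (R - {s}))"
proof -
  define I where "I = inj_maps {1..n} {1..N}"
  define P where "P = prod_bar z N n (insert r R)"
  define W where "W = (\<Sum>s\<in>R. \<Sum>j\<in>I. z (j s) r * prod_along z j R)"
  have fin: "finite R"
    using assms(2) by (rule finite_subset) simp
  have P: "P = (\<Sum>j\<in>I. z (j r) r * prod_along z j R)"
    using fin assms by (simp add: P_def I_def prod_bar_def prod_along_insert)
  have img: "j ` R \<subseteq> {1..N}" "inj_on j R" if "j \<in> I" for j
    using that assms(2) inj_mapsD(1,2)[of j "{1..n}" "{1..N}"] inj_on_subset[of j "{1..n}" R]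
    unfolding I_def by blast+
  have card: "of_nat (card ({1..N} - j ` R)) = (of_nat N - of_nat (card R) :: rat)" if "j \<in> I" for j
  proof -
    have "card (j ` R) \<le> N"
      using card_mono[OF _ img(1)[OF that]] by simp
    then show ?thesis
      using img[OF that] fin by (simp add: card_Diff_subset card_image of_nat_diff)
  qed
  \<comment> \<open>By symmetry \<open>z i r\<close> may be replaced by \<open>z (j r) r\<close>;
    the summand is then free of \<open>i\<close>, and only the number of rows outside the image of
    \<open>R\<close> remains.\<close>
  have "(\<Sum>j\<in>I. prod_along z j R * (\<Sum>i\<in>{1..N} - j ` R. z i r)) =
      (\<Sum>j\<in>I. scale (of_nat N - of_nat (card R)) (prod_along z j R * z (j r) r))"
    using sum_inj_maps_complement[of "{1..n}" "{1..N}" R r z] assms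
    by (simp add: I_def[symmetric] sum_distrib_left sum_constant_scale card del: One_nat_def)
  also have "\<dots> = scale (of_nat N - of_nat (card R)) P"
    by (simp add: P scale_sum_right mult.commute)
  \<comment> \<open>The starting sum of the calculation is evaluated a second time, as all rows
    minus the rows used by \<open>R\<close>.\<close>
  also have "(\<Sum>j\<in>I. prod_along z j R * (\<Sum>i\<in>{1..N} - j ` R. z i r)) =
      (\<Sum>j\<in>I. prod_along z j R * ((\<Sum>i\<in>{1..N}. z i r) - (\<Sum>s\<in>R. z (j s) r)))"
    by (intro sum.cong refl) (simp add: sum_diff img sum.reindex del: One_nat_def)
  also have "\<dots> = prod_bar z N n R * (\<Sum>i\<in>{1..N}. z i r) - W"
    unfolding W_def sum.swap[of _ I R]
    by (simp add: I_def prod_bar_def right_diff_distrib sum_subtractf sum_distrib_right sum_distrib_left mult.commute)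
  finally have complement: "prod_bar z N n R * (\<Sum>i\<in>{1..N}. z i r) = scale (of_nat N - of_nat (card R)) P + W"
    by (simp add: algebra_simps)
  \<comment> \<open>Only the second difference is expanded. The two resulting sums are negatives of
    each other by the exchange, which is the origin of the 2 in the denominator.\<close>
  have "(\<Sum>j\<in>I. col_diff z (j r) (j s) r * col_diff z (j r) (j s) s * prod_along z j (R - {s})) =
      - scale 2 (P - (\<Sum>j\<in>I. z (j s) r * prod_along z j R))" if "s \<in> R" for s
  proof -
    let ?D = "\<lambda>j t. col_diff z (j r) (j s) r * z (j t) s * prod_along z j (R - {s})"
    have "(\<Sum>j\<in>I. col_diff z (j r) (j s) r * col_diff z (j r) (j s) s * prod_along z j (R - {s})) =
        sum (\<lambda>j. ?D j r) I - sum (\<lambda>j. ?D j s) I"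
      unfolding sum_subtractf[symmetric] by (simp add: col_diff_def algebra_simps)
    also have "\<dots> = - scale 2 (sum (\<lambda>j. ?D j s) I)"
      using sum_inj_maps_exchange[of r "{1..n}" s "R - {s}" z "{1..N}"] assms that
        scale_left_distrib[of 1 1 "sum (\<lambda>j. ?D j s) I"]
      by (auto simp: I_def)
    \<comment> \<open>Since \<open>s\<close> lies in \<open>R\<close>, the factor
      \<open>z (j s) s\<close> completes the product over \<open>R - {s}\<close> to the product over
      \<open>R\<close>.\<close>
    also have "sum (\<lambda>j. ?D j s) I = P - (\<Sum>j\<in>I. z (j s) r * prod_along z j R)"
      unfolding P sum_subtractf[symmetric]
      by (simp add: prod_along_remove[OF fin that, of z] col_diff_def algebra_simps)
    finally show ?thesis .
  qed
  then have "(\<Sum>s\<in>R. \<Sum>j\<in>I. col_diff z (j r) (j s) r * col_diff z (j r) (j s) s * prod_along z j (R - {s})) =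
      - scale 2 (scale (of_nat (card R)) P - W)"
    by (simp add: W_def sum_negf scale_sum_right[symmetric] sum_subtractf sum_constant_scale)
  then have "- scale (1 / (2 * of_nat N)) (\<Sum>s\<in>R. \<Sum>j\<in>I.
      col_diff z (j r) (j s) r * col_diff z (j r) (j s) s * prod_along z j (R - {s})) =
      scale (1 / of_nat N) (scale (of_nat (card R)) P - W)"
    by simp
  also have "\<dots> = scale (1 / of_nat N) (scale (of_nat N) P - prod_bar z N n R * (\<Sum>i\<in>{1..N}. z i r))"
    unfolding complement by (simp add: scale_left_diff_distrib)
  also have "\<dots> = P - prod_bar z N n R * col_mean scale z N r"
    using assms(1) by (simp add: scale_right_diff_distrib col_mean_def mult_scale_right)
  finally show ?thesis
    by (simp add: P_def I_def)
qed

definition prod_hybrid :: "(nat \<Rightarrow> nat \<Rightarrow> 'a) \<Rightarrow> nat \<Rightarrow> nat \<Rightarrow> nat set \<Rightarrow> 'a" where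
  "prod_hybrid z N n R = prod_bar z N n R * prod_mean scale z N ({1..n} - R)"

text \<open>The product of means stays inside the sum over \<open>j\<close>, so that unfolding
  yields literally the summand of the averaged formula.\<close>

definition diff_sum :: "(nat \<Rightarrow> nat \<Rightarrow> 'a) \<Rightarrow> nat \<Rightarrow> nat \<Rightarrow> nat set \<Rightarrow> nat \<Rightarrow> nat \<Rightarrow> 'a" where
  "diff_sum z N n R r s = (\<Sum>j\<in>inj_maps {1..n} {1..N}.
     col_diff z (j r) (j s) r * col_diff z (j r) (j s) s
     * prod_along z j (R - {r, s}) * prod_mean scale z N ({1..n} - R))"

lemma prod_hybrid_full: "prod_hybrid z N n {1..n} = prod_bar z N n {1..n}"
  by (simp add: prod_hybrid_def prod_mean_def)

text \<open>Every injective map contributes the empty product 1, so the coefficient is the number of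
  such maps.\<close>

lemma prod_hybrid_empty:
  assumes "n \<le> N"
  shows "prod_hybrid z N n {} = scale (fact N / fact (N - n)) (prod_mean scale z N {1..n})"
proof -
  have "prod_bar z N n {} = scale (fact N / fact (N - n)) 1"
    using assms card_inj_maps[of "{1..n}" "{1..N}"]
    by (simp add: prod_bar_def prod_along_def sum_constant_scale)
  then show ?thesis
    by (simp add: prod_hybrid_def scale_mult[symmetric])
qed

text \<open>Both hybrids share the means of the columns outside \<open>R\<close>; factoring them out
  leaves \<open>prod_bar_insert\<close>. The form with \<open>R - {r}\<close> fits the steps from
  size \<open>k\<close> to \<open>k - 1\<close> in both telescoping sums.\<close>

lemma prod_hybrid_remove:
  assumes "0 < N" "R \<subseteq> {1..n}" "r \<in> R"
  shows "prod_hybrid z N n R - prod_hybrid z N n (R - {r}) =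
    - scale (1 / (2 * of_nat N)) (\<Sum>s\<in>R - {r}. diff_sum z N n R r s)"
proof -
  let ?m = "prod_mean scale z N ({1..n} - R)"
  have "{1..n} - (R - {r}) = insert r ({1..n} - R)"
    using assms by auto
  then have m: "prod_mean scale z N ({1..n} - (R - {r})) = col_mean scale z N r * ?m"
    using assms by (simp add: prod_mean_def)
  have "prod_hybrid z N n R - prod_hybrid z N n (R - {r}) =
      (prod_bar z N n (insert r (R - {r})) - prod_bar z N n (R - {r}) * col_mean scale z N r) * ?m"
    using assms by (simp add: prod_hybrid_def m insert_absorb left_diff_distrib mult.assoc del: One_nat_def)
  also have "\<dots> = - scale (1 / (2 * of_nat N)) (\<Sum>s\<in>R - {r}. \<Sum>j\<in>inj_maps {1..n} {1..N}.
      col_diff z (j r) (j s) r * col_diff z (j r) (j s) s * prod_along z j (R - {r} - {s}) * ?m)"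
    using assms
    by (subst prod_bar_insert) (auto simp: scale_mult[symmetric] sum_distrib_right)
  finally show ?thesis
    by (simp add: diff_sum_def Diff_insert2[of R r "{s}" for s])
qed

section \<open>Telescoping along the chain\<close>

lemma chain_expansion:
  assumes "n \<in> {1..N}" "\<rho> \<in> inj_maps {1..n} {1..n}"
  shows "prod_bar z N n {1..n} - scale (fact N / fact (N - n)) (prod_mean scale z N {1..n}) =
    - scale (1 / (2 * of_nat N))
        (\<Sum>k\<in>{2..n}. \<Sum>s\<in>prefix_set \<rho> (k - 1). \<Sum>j\<in>inj_maps {1..n} {1..N}.
           col_diff z (j (\<rho> k)) (j s) (\<rho> k) * col_diff z (j (\<rho> k)) (j s) s
           * prod_along z j (prefix_set \<rho> (k - 1) - {s})
           * prod_mean scale z N ({1..n} - prefix_set \<rho> k))"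
proof -
  define h where "h k = prod_hybrid z N n (prefix_set \<rho> k)" for k
  define G where "G k = (\<Sum>s\<in>prefix_set \<rho> (k - 1). diff_sum z N n (prefix_set \<rho> k) (\<rho> k) s)" for k
  have pre: "prefix_set \<rho> (k - 1) = prefix_set \<rho> k - {\<rho> k}" if "k \<in> {1..n}" for k
    using that inj_mapsD(1)[OF assms(2)] by (rule prefix_set_remove)
  have "h k - h (k - 1) = - scale (1 / (2 * of_nat N)) (G k)" if "k \<in> {1..n}" for k
  proof -
    have "prefix_set \<rho> k \<subseteq> {1..n}" "\<rho> k \<in> prefix_set \<rho> k"
      using that inj_mapsD(2)[OF assms(2)] by (fastforce simp: prefix_set_def)+
    then show ?thesis
      using prod_hybrid_remove[of N "prefix_set \<rho> k" n "\<rho> k" z] assms(1) pre[OF that]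
      by (simp add: h_def G_def)
  qed
  then have "h n - h 0 = (\<Sum>k\<in>{1..n}. - scale (1 / (2 * of_nat N)) (G k))"
    using sum_telescope''[of 0 n h] by simp
  \<comment> \<open>For \<open>k = 1\<close> the sum over \<open>s\<close> runs over the empty set
    \<open>prefix_set \<rho> 0\<close>, so summation may start at 2.\<close>
  also have "\<dots> = (\<Sum>k\<in>{2..n}. - scale (1 / (2 * of_nat N)) (G k))"
  proof (rule sum.mono_neutral_right)
    show "\<forall>k\<in>{1..n} - {2..n}. - scale (1 / (2 * of_nat N)) (G k) = 0"
    proof
      fix k assume "k \<in> {1..n} - {2..n}"
      then have "k = 1"
        by auto
      then show "- scale (1 / (2 * of_nat N)) (G k) = 0"
        by (simp add: G_def prefix_set_def)
    qed
  qed auto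
  also have "\<dots> = - scale (1 / (2 * of_nat N)) (\<Sum>k\<in>{2..n}. G k)"
    by (simp add: scale_sum_right sum_negf)
  also have "(\<Sum>k\<in>{2..n}. G k) = (\<Sum>k\<in>{2..n}. \<Sum>s\<in>prefix_set \<rho> (k - 1). \<Sum>j\<in>inj_maps {1..n} {1..N}.
           col_diff z (j (\<rho> k)) (j s) (\<rho> k) * col_diff z (j (\<rho> k)) (j s) s
           * prod_along z j (prefix_set \<rho> (k - 1) - {s})
           * prod_mean scale z N ({1..n} - prefix_set \<rho> k))"
  proof (intro sum.cong refl)
    fix k assume "k \<in> {2..n}"
    moreover have "prefix_set \<rho> k - {\<rho> k} - {s} = prefix_set \<rho> k - {\<rho> k, s}" for s
      by auto
    ultimately show "G k = (\<Sum>s\<in>prefix_set \<rho> (k - 1). \<Sum>j\<in>inj_maps {1..n} {1..N}.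
           col_diff z (j (\<rho> k)) (j s) (\<rho> k) * col_diff z (j (\<rho> k)) (j s) s
           * prod_along z j (prefix_set \<rho> (k - 1) - {s})
           * prod_mean scale z N ({1..n} - prefix_set \<rho> k))"
      using pre[of k] by (simp add: G_def diff_sum_def)
  qed
  finally show ?thesis
    using assms prod_hybrid_empty[of n N z] prod_hybrid_full[of z N n] prefix_set_full[OF assms(2)]
    by (simp add: h_def prefix_set_def)
qed

section \<open>Telescoping the means over all subsets of equal size\<close>

lemma averaged_expansion:
  assumes "n \<in> {1..N}"
  shows "prod_bar z N n {1..n} - scale (fact N / fact (N - n)) (prod_mean scale z N {1..n}) =
    - (\<Sum>k\<in>{2..n}. scale (1 / (2 * of_nat N * of_nat k * of_nat (n choose k)))
        (\<Sum>R\<in>{R. R \<subseteq> {1..n} \<and> card R = k}. \<Sum>(r, s)\<in>distinct_pairs R. diff_sum z N n R r s))"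
proof -
  define \<S> where "\<S> k = {R. R \<subseteq> {1..n} \<and> card R = k}" for k
  define g where "g k = scale (1 / of_nat (n choose k)) (\<Sum>R\<in>\<S> k. prod_hybrid z N n R)" for k
  define G where "G k = (\<Sum>R\<in>\<S> k. \<Sum>(r, s)\<in>distinct_pairs R. diff_sum z N n R r s)" for k
  have fin: "R \<subseteq> {1..n} \<Longrightarrow> finite R" for R
    by (rule finite_subset) auto
  have step: "g k - g (k - 1) = - scale (1 / (2 * of_nat N * of_nat k * of_nat (n choose k))) (G k)"
    if k: "k \<in> {1..n}" for k
  proof -
    \<comment> \<open>\<open>d\<close> counts the pairs of a \<open>k\<close>-subset
      \<open>R\<close> and an element \<open>r\<close> of it, equally the pairs of a
      \<open>(k - 1)\<close>-subset and an element outside it. Scaling by \<open>d\<close> thus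
      turns both averages into unweighted sums over the same pairs, and their difference can be
      taken termwise.\<close>
    define d where "d = (of_nat k * of_nat (n choose k) :: rat)"
    have d0: "d \<noteq> 0"
      using k by (simp add: d_def)
    have "k * (n choose k) = (n - (k - 1)) * (n choose (k - 1))"
      using k binomial_absorption[of "k - 1" n] binomial_absorb_comp[of n "k - 1"] by simp
    then have d: "d = of_nat (n - (k - 1)) * of_nat (n choose (k - 1))"
      unfolding d_def by (metis of_nat_mult)
    have "scale d (g k) = (\<Sum>R\<in>\<S> k. scale (of_nat k) (prod_hybrid z N n R))"
      using k by (simp add: d_def g_def scale_sum_right)
    also have "\<dots> = (\<Sum>R\<in>\<S> k. \<Sum>r\<in>R. prod_hybrid z N n R)"
      by (intro sum.cong refl) (simp add: \<S>_def sum_constant_scale)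
    finally have gk: "scale d (g k) = \<dots>" .
    \<comment> \<open>The weight left over is the number of columns outside a set of size
      \<open>k - 1\<close>, that is, the number of ways to enlarge it by one column.\<close>
    have "scale d (g (k - 1)) = (\<Sum>R\<in>\<S> (k - 1). scale (of_nat (n - (k - 1))) (prod_hybrid z N n R))"
    proof -
      have "d * (1 / of_nat (n choose (k - 1))) = of_nat (n - (k - 1))"
        using d0 by (simp add: d)
      then show ?thesis
        by (simp only: g_def scale_scale scale_sum_right)
    qed
    also have "\<dots> = (\<Sum>R\<in>\<S> (k - 1). \<Sum>r\<in>{1..n} - R. prod_hybrid z N n R)"
      by (intro sum.cong refl) (simp add: \<S>_def sum_constant_scale card_Diff_subset fin)
    also have "\<dots> = (\<Sum>R\<in>\<S> k. \<Sum>r\<in>R. prod_hybrid z N n (R - {r}))"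
      unfolding \<S>_def using k by (subst sum_insert_subsets) auto
    finally have gk': "scale d (g (k - 1)) = \<dots>" .
    have "scale d (g k - g (k - 1)) =
        (\<Sum>R\<in>\<S> k. \<Sum>r\<in>R. prod_hybrid z N n R - prod_hybrid z N n (R - {r}))"
      by (simp add: scale_right_diff_distrib gk gk' sum_subtractf del: One_nat_def)
    also have "\<dots> = (\<Sum>R\<in>\<S> k. \<Sum>r\<in>R. - scale (1 / (2 * of_nat N)) (\<Sum>s\<in>R - {r}. diff_sum z N n R r s))"
      using assms by (intro sum.cong refl prod_hybrid_remove) (auto simp: \<S>_def)
    also have "\<dots> = - scale (1 / (2 * of_nat N)) (\<Sum>R\<in>\<S> k. \<Sum>r\<in>R. \<Sum>s\<in>R - {r}. diff_sum z N n R r s)"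
      by (simp add: scale_sum_right sum_negf)
    also have "(\<Sum>R\<in>\<S> k. \<Sum>r\<in>R. \<Sum>s\<in>R - {r}. diff_sum z N n R r s) = G k"
      unfolding G_def
    proof (intro sum.cong refl)
      fix R assume "R \<in> \<S> k"
      moreover have "distinct_pairs R = (SIGMA r:R. R - {r})"
        by (auto simp: distinct_pairs_def)
      ultimately show "(\<Sum>r\<in>R. \<Sum>s\<in>R - {r}. diff_sum z N n R r s) =
          (\<Sum>(r, s)\<in>distinct_pairs R. diff_sum z N n R r s)"
        by (simp add: sum.Sigma fin \<S>_def)
    qed
    finally have "scale (1 / d) (scale d (g k - g (k - 1))) = scale (1 / d) (- scale (1 / (2 * of_nat N)) (G k))"
      by simp
    then show ?thesis
      using d0 by (simp add: d_def mult_ac)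
  qed
  \<comment> \<open>A singleton contains no pair of distinct columns.\<close>
  have zero: "G k = 0" if "k \<in> {1..n} - {2..n}" for k
  proof -
    have "k = 1"
      using that by auto
    then have "distinct_pairs R = {}" if "R \<in> \<S> k" for R
      using that by (auto simp: \<S>_def distinct_pairs_def card_1_singleton_iff)
    then show ?thesis
      by (simp add: G_def)
  qed
  have "g n - g 0 = (\<Sum>k\<in>{1..n}. - scale (1 / (2 * of_nat N * of_nat k * of_nat (n choose k))) (G k))"
    using sum_telescope''[of 0 n g] step by simp
  also have "\<dots> = (\<Sum>k\<in>{2..n}. - scale (1 / (2 * of_nat N * of_nat k * of_nat (n choose k))) (G k))"
    by (rule sum.mono_neutral_right) (auto simp: zero)
  also have "\<dots> = - (\<Sum>k\<in>{2..n}. scale (1 / (2 * of_nat N * of_nat k * of_nat (n choose k))) (G k))"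
    by (simp add: sum_negf)
  \<comment> \<open>At both ends of the telescope there is a single subset, so the average is one
    hybrid.\<close>
  moreover have "\<S> n = {{1..n}}"
    using card_subset_eq[of "{1..n}"] by (auto simp: \<S>_def)
  moreover have "\<S> 0 = {{}}"
    using fin by (auto simp: \<S>_def)
  ultimately show ?thesis
    using assms prod_hybrid_empty[of n N z] prod_hybrid_full[of z N n]
    by (simp add: g_def G_def \<S>_def)
qed

section \<open>Resummation by row pairs and column pairs\<close>

lemma sum_diff_sum_by_values:
  assumes "2 \<le> k"
  shows "(\<Sum>R\<in>{R. R \<subseteq> {1..n} \<and> card R = k}. \<Sum>(r, s)\<in>distinct_pairs R. diff_sum z N n R r s) =
    (\<Sum>(u, v)\<in>distinct_pairs {1..N}. \<Sum>(r, s)\<in>distinct_pairs {1..n}.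
       col_diff z u v r * col_diff z u v s *
       (\<Sum>R\<in>{R. R \<subseteq> {1..n} - {r, s} \<and> card R = k - 2}.
          prod_mean scale z N ({1..n} - (R \<union> {r, s})) *
          (\<Sum>j\<in>inj_maps ({1..n} - {r, s}) ({1..N} - {u, v}). prod_along z j R)))"
proof -
  \<comment> \<open>Once \<open>j\<close> takes the values \<open>u\<close>, \<open>v\<close> at the
    two marked columns, both differences are constant. As \<open>R\<close> avoids these columns,
    \<open>prod_along\<close> sees only the rest of \<open>j\<close>.\<close>
  have by_values: "diff_sum z N n (R \<union> {fst p, snd p}) (fst p) (snd p) = (\<Sum>(u, v)\<in>distinct_pairs {1..N}.
      col_diff z u v (fst p) * col_diff z u v (snd p) *
        (prod_mean scale z N ({1..n} - (R \<union> {fst p, snd p})) *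
          (\<Sum>j\<in>inj_maps ({1..n} - {fst p, snd p}) ({1..N} - {u, v}). prod_along z j R)))"
    if p: "p \<in> distinct_pairs {1..n}" and R: "R \<subseteq> {1..n} - {fst p, snd p}" for R p
  proof -
    have R': "R \<union> {fst p, snd p} - {fst p, snd p} = R"
      using R by auto
    have "fst p \<in> {1..n}" "snd p \<in> {1..n}" "fst p \<noteq> snd p"
      using p by (auto simp: distinct_pairs_def)
    moreover have "prod_along z (j(fst p := u, snd p := v)) R = prod_along z j R" for j u v
      using R by (intro prod_along_cong) auto
    ultimately show ?thesis
      unfolding diff_sum_def R' split_def
      by (subst sum_inj_maps_split[where r = "fst p" and s = "snd p"])
        (simp_all add: sum_distrib_left sum_distrib_right mult_ac)
  qed
  have "(\<Sum>R\<in>{R. R \<subseteq> {1..n} \<and> card R = k}. \<Sum>(r, s)\<in>distinct_pairs R. diff_sum z N n R r s) =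
      (\<Sum>(r, s)\<in>distinct_pairs {1..n}. \<Sum>R\<in>{R. R \<subseteq> {1..n} - {r, s} \<and> card R = k - 2}.
        diff_sum z N n (R \<union> {r, s}) r s)"
    using sum_distinct_pairs_subsets[of "{1..n}" k "\<lambda>R p. diff_sum z N n R (fst p) (snd p)"] assms
    by (simp add: split_def)
  also have "\<dots> = (\<Sum>(r, s)\<in>distinct_pairs {1..n}. \<Sum>R\<in>{R. R \<subseteq> {1..n} - {r, s} \<and> card R = k - 2}.
      \<Sum>(u, v)\<in>distinct_pairs {1..N}.
        col_diff z u v r * col_diff z u v s * (prod_mean scale z N ({1..n} - (R \<union> {r, s})) *
          (\<Sum>j\<in>inj_maps ({1..n} - {r, s}) ({1..N} - {u, v}). prod_along z j R)))"
    unfolding split_def by (intro sum.cong refl by_values[unfolded split_def]) auto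
  also have "\<dots> = (\<Sum>(r, s)\<in>distinct_pairs {1..n}. \<Sum>(u, v)\<in>distinct_pairs {1..N}.
       col_diff z u v r * col_diff z u v s *
       (\<Sum>R\<in>{R. R \<subseteq> {1..n} - {r, s} \<and> card R = k - 2}.
          prod_mean scale z N ({1..n} - (R \<union> {r, s})) *
          (\<Sum>j\<in>inj_maps ({1..n} - {r, s}) ({1..N} - {u, v}). prod_along z j R)))"
    \<comment> \<open>Projections replace the case expressions so that \<open>sum.swap\<close>
      applies; the sum over row pairs is moved outside the sum over \<open>R\<close>, and in the
      last step also outside the sum over column pairs.\<close>
    unfolding split_def sum_distrib_left by (intro sum.cong refl sum.swap)
  finally show ?thesis
    unfolding split_def by (rule trans[OF _ sum.swap])
qed

end

section \<open>The chain and the three expansions combined\<close>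

theorem theorem3p6:
  fixes scale :: "rat \<Rightarrow> 'a::{comm_ring, comm_monoid_mult} \<Rightarrow> 'a"
    and N n :: nat
    and z :: "nat \<Rightarrow> nat \<Rightarrow> 'a"
    and \<rho> :: "nat \<Rightarrow> nat"
  assumes "rat_algebra scale"
    and "n \<in> {1..N}"
    and "\<rho> \<in> inj_maps {1..n} {1..n}"
  shows "prefix_set \<rho> 0 = {} \<and>
      (\<forall>k\<in>{1..n}. prefix_set \<rho> (k - 1) \<subset> prefix_set \<rho> k) \<and>
      prefix_set \<rho> n = {1..n} \<and>
      subset.maxchain (Pow {1..n}) (prefix_set \<rho> ` {0..n}) \<and>
      prod_bar z N n {1..n} - scale (fact N / fact (N - n)) (prod_mean scale z N {1..n}) =
      - scale (1 / (2 * of_nat N))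
          (\<Sum>k\<in>{2..n}. \<Sum>s\<in>prefix_set \<rho> (k - 1). \<Sum>j\<in>inj_maps {1..n} {1..N}.
             col_diff z (j (\<rho> k)) (j s) (\<rho> k) * col_diff z (j (\<rho> k)) (j s) s
             * prod_along z j (prefix_set \<rho> (k - 1) - {s})
             * prod_mean scale z N ({1..n} - prefix_set \<rho> k)) \<and>
      prod_bar z N n {1..n} - scale (fact N / fact (N - n)) (prod_mean scale z N {1..n}) =
      - (\<Sum>k\<in>{2..n}. scale (1 / (2 * of_nat N * of_nat k * of_nat (n choose k)))
          (\<Sum>R\<in>{R. R \<subseteq> {1..n} \<and> card R = k}. \<Sum>(r, s)\<in>distinct_pairs R.
             \<Sum>j\<in>inj_maps {1..n} {1..N}.
               col_diff z (j r) (j s) r * col_diff z (j r) (j s) s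
               * prod_along z j (R - {r, s}) * prod_mean scale z N ({1..n} - R))) \<and>
      - (\<Sum>k\<in>{2..n}. scale (1 / (2 * of_nat N * of_nat k * of_nat (n choose k)))
          (\<Sum>R\<in>{R. R \<subseteq> {1..n} \<and> card R = k}. \<Sum>(r, s)\<in>distinct_pairs R.
             \<Sum>j\<in>inj_maps {1..n} {1..N}.
               col_diff z (j r) (j s) r * col_diff z (j r) (j s) s
               * prod_along z j (R - {r, s}) * prod_mean scale z N ({1..n} - R))) =
      - (\<Sum>(u, v)\<in>distinct_pairs {1..N}. \<Sum>(r, s)\<in>distinct_pairs {1..n}.
          col_diff z u v r * col_diff z u v s
          * (\<Sum>k\<in>{2..n}. scale (1 / (2 * of_nat N * of_nat k * of_nat (n choose k)))
              (\<Sum>R\<in>{R. R \<subseteq> {1..n} - {r, s} \<and> card R = k - 2}.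
                 prod_mean scale z N ({1..n} - (R \<union> {r, s}))
                 * (\<Sum>j\<in>inj_maps ({1..n} - {r, s}) ({1..N} - {u, v}). prod_along z j R))))"
proof -
  interpret rat_algebra scale by fact
  have strict: "\<forall>k\<in>{1..n}. prefix_set \<rho> (k - 1) \<subset> prefix_set \<rho> k"
  proof
    fix k assume "k \<in> {1..n}"
    moreover from this have "\<rho> k \<in> prefix_set \<rho> k"
      by (auto simp: prefix_set_def)
    ultimately show "prefix_set \<rho> (k - 1) \<subset> prefix_set \<rho> k"
      using prefix_set_remove inj_mapsD(1)[OF assms(3)] by blast
  qed
  have third: "(\<Sum>k\<in>{2..n}. scale (1 / (2 * of_nat N * of_nat k * of_nat (n choose k)))
      (\<Sum>R\<in>{R. R \<subseteq> {1..n} \<and> card R = k}. \<Sum>(r, s)\<in>distinct_pairs R. diff_sum z N n R r s)) =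
    (\<Sum>(u, v)\<in>distinct_pairs {1..N}. \<Sum>(r, s)\<in>distinct_pairs {1..n}.
      col_diff z u v r * col_diff z u v s
      * (\<Sum>k\<in>{2..n}. scale (1 / (2 * of_nat N * of_nat k * of_nat (n choose k)))
          (\<Sum>R\<in>{R. R \<subseteq> {1..n} - {r, s} \<and> card R = k - 2}.
             prod_mean scale z N ({1..n} - (R \<union> {r, s}))
             * (\<Sum>j\<in>inj_maps ({1..n} - {r, s}) ({1..N} - {u, v}). prod_along z j R))))"
    (is "?A = ?B")
  proof -
    \<comment> \<open>In \<open>?X\<close> and \<open>?y\<close> the pair \<open>p\<close> holds the
      columns and \<open>q\<close> the rows. The scalar \<open>?c k\<close> is pushed to the
      innermost term, the sum over \<open>k\<close> is moved inside both pair sums, and then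
      \<open>?y p q\<close>, which is free of \<open>k\<close>, is factored out.\<close>
    let ?c = "\<lambda>k. 1 / (2 * of_nat N * of_nat k * of_nat (n choose k)) :: rat"
    let ?X = "\<lambda>k p q. \<Sum>R\<in>{R. R \<subseteq> {1..n} - {fst p, snd p} \<and> card R = k - 2}.
      prod_mean scale z N ({1..n} - (R \<union> {fst p, snd p}))
      * (\<Sum>j\<in>inj_maps ({1..n} - {fst p, snd p}) ({1..N} - {fst q, snd q}). prod_along z j R)"
    let ?y = "\<lambda>p q. col_diff z (fst q) (snd q) (fst p) * col_diff z (fst q) (snd q) (snd p)"
    have "?A = (\<Sum>k\<in>{2..n}. \<Sum>q\<in>distinct_pairs {1..N}. \<Sum>p\<in>distinct_pairs {1..n}. scale (?c k) (?y p q * ?X k p q))"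
    proof (intro sum.cong refl)
      fix k assume "k \<in> {2..n}"
      then have "2 \<le> k"
        by simp
      then show "scale (?c k) (\<Sum>R\<in>{R. R \<subseteq> {1..n} \<and> card R = k}. \<Sum>(r, s)\<in>distinct_pairs R. diff_sum z N n R r s) =
          (\<Sum>q\<in>distinct_pairs {1..N}. \<Sum>p\<in>distinct_pairs {1..n}. scale (?c k) (?y p q * ?X k p q))"
        by (simp only: sum_diff_sum_by_values) (simp only: scale_sum_right split_def)
    qed
    also have "\<dots> = (\<Sum>q\<in>distinct_pairs {1..N}. \<Sum>k\<in>{2..n}. \<Sum>p\<in>distinct_pairs {1..n}. scale (?c k) (?y p q * ?X k p q))"
      by (rule sum.swap)
    also have "\<dots> = (\<Sum>q\<in>distinct_pairs {1..N}. \<Sum>p\<in>distinct_pairs {1..n}. \<Sum>k\<in>{2..n}. scale (?c k) (?y p q * ?X k p q))"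
      by (intro sum.cong refl sum.swap)
    also have "\<dots> = (\<Sum>q\<in>distinct_pairs {1..N}. \<Sum>p\<in>distinct_pairs {1..n}. ?y p q * (\<Sum>k\<in>{2..n}. scale (?c k) (?X k p q)))"
      by (simp only: sum_distrib_left[of "?y _ _" _ "{2..n}"] mult_scale_right)
    finally show ?thesis
      by (simp only: split_def)
  qed
  have "prefix_set \<rho> 0 = {}"
    by (simp add: prefix_set_def)
  \<comment> \<open>For \<open>n = 1\<close> the range \<open>{2..n}\<close> and the set of column
    pairs are empty, so the convention that the right-hand sides vanish is built in.\<close>
  then show ?thesis
    using strict prefix_set_full[OF assms(3)] maxchain_prefix_set[OF assms(3)]
      chain_expansion[OF assms(2,3), of z] averaged_expansion[OF assms(2), of z]
      arg_cong[OF third, of uminus]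
    unfolding diff_sum_def by (intro conjI)
qed

end
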